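(* Let $\mathbb{Z}_3^n$ denote the $n$-dimensional discrete torus of side length $3$ (the $n$-th Cartesian power of the triangle). Then the number $|\mathcal{I}(\mathbb{Z}_3^n)|$ of independent sets of $\mathbb{Z}_3^n$ satisfies \[ |\mathcal{I}(\mathbb{Z}_3^n)| \geq (1-o(1)) \cdot 3 \cdot 2^{n-1} \cdot 2^{3^{n-1}} \cdot \exp\big( (3/2)^{n-1} \big) \] as $n \to \infty$.
   Context: For $m,n\in\mathbb{N}$, the discrete torus $\mathbb{Z}_m^n$ is the graph with vertex set $\{0,1,\ldots,m-1\}^n$ in which $u,v$ are adjacent iff there is $j\in[n]$ with $u_j \equiv v_j \pm 1 \pmod m$ and $u_i=v_i$ for all $i\neq j$. An independent set is a vertex set spanning no edges (the empty set included). $o(1)$ denotes a quantity tending to $0$ as $n\to\infty$. *)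

theory Defs
  imports Complex_Main "HOL-Library.FuncSet" "HOL-Number_Theory.Cong"
begin

text \<open>
  Vertices of the torus are extensional functions on the coordinate set \<open>{..<n}\<close>
  (coordinates are numbered from 0), so that the vertex set has exactly \<open>m ^ n\<close> elements.
\<close>

definition torus_verts :: "nat \<Rightarrow> nat \<Rightarrow> (nat \<Rightarrow> nat) set" where
  "torus_verts m n = {..<n} \<rightarrow>\<^sub>E {..<m}"

definition torus_adj :: "nat \<Rightarrow> nat \<Rightarrow> (nat \<Rightarrow> nat) \<Rightarrow> (nat \<Rightarrow> nat) \<Rightarrow> bool" where
  "torus_adj m n u v \<longleftrightarrow>
     (\<exists>j<n. ([int (u j) = int (v j) + 1] (mod int m) \<or> [int (u j) = int (v j) - 1] (mod int m))
          \<and> (\<forall>i<n. i \<noteq> j \<longrightarrow> u i = v i))"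

definition indep_sets :: "'a set \<Rightarrow> ('a \<Rightarrow> 'a \<Rightarrow> bool) \<Rightarrow> 'a set set" where
  "indep_sets V adj = {I. I \<subseteq> V \<and> (\<forall>u\<in>I. \<forall>v\<in>I. \<not> adj u v)}"

definition torus_indep_sets :: "nat \<Rightarrow> nat \<Rightarrow> (nat \<Rightarrow> nat) set set" where
  "torus_indep_sets m n = indep_sets (torus_verts m n) (torus_adj m n)"

end

(*
Each linear form with coefficients +1 or -1 over Z_3 yields a maximum independent set M,
the points where the form takes a given value; up to sign there are 3 * 2^(n-1) of them.
An independent set close to M consists of a small independent set D of defects outside M
and a subset of M avoiding the neighbours of D.  A defect has at most n neighbours in M, and
2 * 3^(n-1) / 2^n = (3/2)^(n-1) =: mu, so k defects contribute about mu^k / k! times 2^(3^(n-1));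
summing up to k = 3 mu gives the factor exp mu.  Two different M share at most 3^(n-2) points,
hence requiring more than 3^(n-2) + K points in M and at most K outside makes the
families counted for different M disjoint.
*)
theory Submission
  imports Defs "HOL-Real_Asymp.Real_Asymp"
begin

section \<open>Subset counts by size, and truncation of the exponential series\<close>

lemma sum_Pow_power_card:
  fixes x :: "'b::comm_semiring_1"
  assumes "finite A"
  shows "(\<Sum>S\<in>Pow A. x ^ card S) = (1 + x) ^ card A"
  using assms
proof (induction A)
  case (insert a A)
  have inj: "inj_on (insert a) (Pow A)"
    using insert.hyps by (auto simp: inj_on_def)
  have "(\<Sum>S\<in>Pow (insert a A). x ^ card S)
      = (\<Sum>S\<in>Pow A. x ^ card S) + (\<Sum>S\<in>insert a ` Pow A. x ^ card S)"
    unfolding Pow_insert by (intro sum.union_disjoint) (use insert.hyps in auto)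
  also have "(\<Sum>S\<in>insert a ` Pow A. x ^ card S) = (\<Sum>S\<in>Pow A. x * x ^ card S)"
    unfolding sum.reindex[OF inj] o_def
  proof (intro sum.cong refl)
    fix S assume "S \<in> Pow A"
    then have "finite S" "a \<notin> S" using insert.hyps by (auto intro: finite_subset)
    then show "x ^ card (insert a S) = x * x ^ card S" by simp
  qed
  finally show ?case
    using insert by (simp add: sum_distrib_left[symmetric] algebra_simps)
qed simp

text \<open>Exponential Markov bound: the weight \<open>2 ^ t * (1 / 2) ^ card S\<close> is at least
  1 on every counted set, and its total over all subsets is a binomial sum with ratio
  \<open>1 / 2\<close>.\<close>

lemma card_small_subsets_le:
  assumes "finite A"
  shows "real (card {S. S \<subseteq> A \<and> card S \<le> t}) \<le> 2 ^ t * (3 / 2) ^ card A"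
proof -
  have "real (card {S. S \<subseteq> A \<and> card S \<le> t}) = (\<Sum>S | S \<subseteq> A \<and> card S \<le> t. 1)"
    by simp
  also have "\<dots> \<le> (\<Sum>S | S \<subseteq> A \<and> card S \<le> t. 2 ^ t * (1 / 2) ^ card S)"
  proof (intro sum_mono)
    fix S assume "S \<in> {S. S \<subseteq> A \<and> card S \<le> t}"
    then have "(2::real) ^ card S \<le> 2 ^ t" by (simp add: power_increasing)
    then show "(1::real) \<le> 2 ^ t * (1 / 2) ^ card S" by (simp add: field_simps power_divide)
  qed
  also have "\<dots> \<le> (\<Sum>S\<in>Pow A. 2 ^ t * (1 / 2) ^ card S)"
    by (intro sum_mono2) (use assms in auto)
  also have "\<dots> = 2 ^ t * (3 / 2) ^ card A"
    using sum_Pow_power_card[OF assms, of "1/2::real"] by (simp add: sum_distrib_left[symmetric])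
  finally show ?thesis .
qed

text \<open>The lost fraction \<open>2 ^ t * (3 / 4) ^ card A\<close> is tiny once
  \<open>card A\<close> is close to \<open>3 * t\<close>, because
  \<open>2 * (3 / 4) ^ 3 = 27 / 32 < 1\<close>. This is the regime in which the bound is
  applied.\<close>

lemma card_large_subsets_ge:
  assumes "finite A"
  shows "real (card {S. S \<subseteq> A \<and> t < card S}) \<ge> 2 ^ card A * (1 - 2 ^ t * (3 / 4) ^ card A)"
proof -
  have "Pow A = {S. S \<subseteq> A \<and> card S \<le> t} \<union> {S. S \<subseteq> A \<and> t < card S}" by auto
  then have "card (Pow A) = card {S. S \<subseteq> A \<and> card S \<le> t} + card {S. S \<subseteq> A \<and> t < card S}"
    using assms by (subst card_Un_disjoint[symmetric]) auto
  then have "real (2 ^ card A) = real (card {S. S \<subseteq> A \<and> card S \<le> t} + card {S. S \<subseteq> A \<and> t < card S})"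
    by (simp only: card_Pow[OF assms])
  then have "real (card {S. S \<subseteq> A \<and> t < card S}) = 2 ^ card A - real (card {S. S \<subseteq> A \<and> card S \<le> t})"
    by simp
  also have "\<dots> \<ge> 2 ^ card A - 2 ^ t * (3 / 2) ^ card A"
    using card_small_subsets_le[OF assms, of t] by simp
  also have "(3 / 2 :: real) ^ card A = 2 ^ card A * (3 / 4) ^ card A"
    by (subst power_mult_distrib[symmetric]) simp
  also have "(2::real) ^ card A - 2 ^ t * (2 ^ card A * (3 / 4) ^ card A)
      = 2 ^ card A * (1 - 2 ^ t * (3 / 4) ^ card A)"
    by (simp only: right_diff_distrib mult_1_right mult_ac)
  finally show ?thesis .
qed

text \<open>The constant 3 serves as an upper bound for \<open>exp 1\<close>; it makes the tail
  beyond \<open>K\<close> at most 1. Such an absolute error costs only a relative error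
  \<open>exp (- x)\<close>, which vanishes as \<open>x\<close> grows.\<close>

lemma exp_partial_sum_ge:
  fixes x :: real
  assumes "0 \<le> x" "3 * x \<le> real K"
  shows "(\<Sum>k\<le>K. x ^ k / fact k) \<ge> exp x - 1"
proof -
  \<comment> \<open>Chernoff: for \<open>k > K\<close>, multiply the term by \<open>exp (k - K) \<ge> 1\<close>\<close>
  have le: "x ^ k / fact k \<le> (if k \<in> {..K} then x ^ k / fact k else 0)
      + exp (- real K) * ((exp 1 * x) ^ k / fact k)" for k
  proof (cases "k \<le> K")
    case False
    have "1 \<le> exp (- real K) * exp 1 ^ k"
      using False by (simp add: exp_of_nat_mult[symmetric] exp_add[symmetric])
    then have "1 * (x ^ k / fact k) \<le> (exp (- real K) * exp 1 ^ k) * (x ^ k / fact k)"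
      by (intro mult_right_mono) (use assms in auto)
    with False show ?thesis by (simp add: power_mult_distrib mult_ac)
  qed (use assms in auto)
  have sums_exp: "(\<lambda>k. y ^ k / fact k) sums exp y" for y :: real
    using exp_converges[of y] by (simp add: divide_inverse mult.commute)
  have "exp x \<le> (\<Sum>k\<le>K. x ^ k / fact k) + exp (- real K) * exp (exp 1 * x)"
    by (rule sums_le[OF le sums_exp sums_add[OF sums_If_finite_set sums_mult[OF sums_exp]]]) simp
  moreover have "exp 1 * x \<le> real K"
    using mult_right_mono[OF exp_le assms(1)] assms(2) by simp
  then have "exp (- real K) * exp (exp 1 * x) \<le> 1"
    by (simp add: exp_add[symmetric])
  ultimately show ?thesis by simp
qed

section \<open>Independent sets of given size in a graph of bounded degree\<close>

lemma indep_sets_finite: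
  "finite V \<Longrightarrow> finite (indep_sets V adj)"
  by (rule finite_subset[of _ "Pow V"]) (auto simp: indep_sets_def)

text \<open>Double counting of independent sets of size \<open>Suc k\<close> with one marked vertex:
  each arises from an independent set of size \<open>k\<close> by adding the mark, and each of the
  \<open>k\<close> old vertices forbids at most \<open>Suc d\<close> choices (itself and its
  neighbours). If the truncated subtraction gives 0, the bound is trivial.\<close>

lemma card_indep_sets_Suc_ge:
  assumes fin: "finite W"
    and sym: "\<And>u v. adj u v \<Longrightarrow> adj v u" and irrefl: "\<And>v. \<not> adj v v"
    and deg: "\<And>v. v \<in> W \<Longrightarrow> card {u \<in> W. adj u v} \<le> d"
  shows "card {D \<in> indep_sets W adj. card D = k} * (card W - k * Suc d)
      \<le> Suc k * card {D \<in> indep_sets W adj. card D = Suc k}"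
proof -
  define J where "J = (\<lambda>k. {D \<in> indep_sets W adj. card D = k})"
  \<comment> \<open>\<open>F D\<close> collects the vertices by which \<open>D\<close> can be
    extended to a larger independent set.\<close>
  define F where "F = (\<lambda>D. W - (\<Union>v\<in>D. insert v {u \<in> W. adj u v}))"
  have finJ: "finite (J k)" for k using indep_sets_finite[OF fin] by (simp add: J_def)
  have finD: "finite D" "D \<subseteq> W" if "D \<in> J k" for D k
    using that fin by (auto simp: J_def indep_sets_def intro: finite_subset)
  have F: "card W - k * Suc d \<le> card (F D)" if "D \<in> J k" for D
  proof -
    have "card (\<Union>v\<in>D. insert v {u \<in> W. adj u v}) \<le> (\<Sum>v\<in>D. card (insert v {u \<in> W. adj u v}))"
      using finD[OF that] by (intro card_UN_le)
    also have "\<dots> \<le> (\<Sum>v\<in>D. Suc d)"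
    proof (intro sum_mono)
      fix v assume "v \<in> D"
      with finD[OF that] deg show "card (insert v {u \<in> W. adj u v}) \<le> Suc d"
        by (intro order.trans[OF card_insert_le_m1]) (auto simp: subset_iff)
    qed
    finally have "card (\<Union>v\<in>D. insert v {u \<in> W. adj u v}) \<le> k * Suc d"
      using that by (simp add: J_def)
    moreover have "card W - card (\<Union>v\<in>D. insert v {u \<in> W. adj u v}) \<le> card (F D)"
      unfolding F_def by (rule diff_card_le_card_Diff) (use finD[OF that] fin in auto)
    ultimately show ?thesis by simp
  qed
  have "card (J k) * (card W - k * Suc d) = (\<Sum>D\<in>J k. card W - k * Suc d)" by simp
  also have "\<dots> \<le> (\<Sum>D\<in>J k. card (F D))" by (intro sum_mono F)
  also have "\<dots> = card (SIGMA D:J k. F D)"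
    using finJ fin by (subst card_SigmaI) (auto simp: F_def)
  also have "\<dots> \<le> card (SIGMA D:J (Suc k). D)"
  proof (rule card_inj_on_le)
    show "inj_on (\<lambda>(D, v). (insert v D, v)) (SIGMA D:J k. F D)"
      by (rule inj_on_inverseI[where g = "\<lambda>(D, v). (D - {v}, v)"]) (auto simp: F_def)
    show "(\<lambda>(D, v). (insert v D, v)) ` (SIGMA D:J k. F D) \<subseteq> (SIGMA D:J (Suc k). D)"
    proof clarsimp
      fix D v assume D: "D \<in> J k" and v: "v \<in> F D"
      have "v \<notin> D" using v by (auto simp: F_def)
      then show "insert v D \<in> J (Suc k)"
        using finD[OF D] D v sym irrefl by (auto simp: J_def F_def indep_sets_def)
    qed
    show "finite (SIGMA D:J (Suc k). D)" using finJ finD by (intro finite_SigmaI) auto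
  qed
  also have "\<dots> = (\<Sum>D\<in>J (Suc k). card D)" using finJ finD by (subst card_SigmaI) auto
  also have "\<dots> = Suc k * card (J (Suc k))" by (simp add: J_def)
  finally show ?thesis by (simp add: J_def)
qed

text \<open>Iterating the extension bound gives \<open>N ^ k / fact k\<close> times the product of
  the factors \<open>1 - j * q\<close> for \<open>j < k\<close>, where \<open>N = card W\<close> and
  \<open>q = (d + 1) / N\<close>; this product is at least \<open>1 - k ^ 2 * q\<close> as long as
  its factors are nonnegative. So almost all \<open>k\<close>-subsets are independent while
  \<open>k ^ 2 * d\<close> is small against \<open>N\<close>.\<close>

lemma card_indep_sets_ge:
  assumes fin: "finite W" and ne: "W \<noteq> {}"
    and sym: "\<And>u v. adj u v \<Longrightarrow> adj v u" and irrefl: "\<And>v. \<not> adj v v"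
    and deg: "\<And>v. v \<in> W \<Longrightarrow> card {u \<in> W. adj u v} \<le> d"
  shows "real (card {D \<in> indep_sets W adj. card D = k})
      \<ge> real (card W) ^ k / fact k * (1 - real k ^ 2 * (real d + 1) / real (card W))"
proof (induction k)
  case 0
  have "{D \<in> indep_sets W adj. card D = 0} = {{}}"
    using fin by (auto simp: indep_sets_def dest: finite_subset)
  then show ?case by simp
next
  case (Suc k)
  define N where "N = real (card W)"
  define q where "q = (real d + 1) / N"
  define i where "i = (\<lambda>k. real (card {D \<in> indep_sets W adj. card D = k}))"
  have N: "N > 0" using fin ne by (simp add: N_def card_gt_0_iff)
  have q: "q \<ge> 0" using N by (simp add: q_def)
  have IH: "i k \<ge> N ^ k / fact k * (1 - real k ^ 2 * q)"
    using Suc by (simp add: i_def N_def q_def)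
  have i0: "i k \<ge> 0" for k by (simp add: i_def)
  have "N ^ Suc k / fact (Suc k) * (1 - real (Suc k) ^ 2 * q) \<le> i (Suc k)"
  \<comment> \<open>The induction hypothesis is multiplied by \<open>1 - k * q\<close>, which must
    be nonnegative; in the other case the claimed lower bound is at most 0.\<close>
  proof (cases "real k * q \<le> 1")
    case True
    have "i k * (N * (1 - real k * q)) = i k * (real (card W) - real (k * Suc d))"
      using N by (simp add: q_def N_def field_simps)
    also have "\<dots> \<le> i k * real (card W - k * Suc d)"
      \<comment> \<open>Truncated subtraction on \<open>nat\<close> can only exceed the real
        difference.\<close>
      by (intro mult_left_mono i0) linarith
    also have "\<dots> \<le> real (Suc k) * i (Suc k)"
      unfolding i_def of_nat_mult[symmetric] of_nat_le_iff
      by (rule card_indep_sets_Suc_ge[OF fin sym irrefl deg])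
    finally have step: "i k * (N * (1 - real k * q)) \<le> real (Suc k) * i (Suc k)" .
    have "1 - real (Suc k) ^ 2 * q \<le> (1 - real k ^ 2 * q) * (1 - real k * q)"
    proof -
      have "(1 - real k ^ 2 * q) * (1 - real k * q) - (1 - real (Suc k) ^ 2 * q)
          = (real k + 1) * q + real k ^ 3 * q ^ 2"
        by (simp add: algebra_simps power2_eq_square power3_eq_cube)
      also have "\<dots> \<ge> 0" using q by simp
      finally show ?thesis by simp
    qed
    then have "N ^ Suc k / fact k * (1 - real (Suc k) ^ 2 * q)
        \<le> N ^ Suc k / fact k * ((1 - real k ^ 2 * q) * (1 - real k * q))"
      using N by (intro mult_left_mono) auto
    also have "\<dots> = (N ^ k / fact k * (1 - real k ^ 2 * q)) * (N * (1 - real k * q))"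
      by simp
    also have "\<dots> \<le> i k * (N * (1 - real k * q))"
      using IH N True by (intro mult_right_mono) auto
    also note step
    finally have "N ^ Suc k / fact k * (1 - real (Suc k) ^ 2 * q) / real (Suc k) \<le> i (Suc k)"
      by (subst pos_divide_le_eq) (simp_all only: mult.commute of_nat_0_less_iff zero_less_Suc)
    then show ?thesis by (simp add: mult.commute)
  next
    case False
    have "real k * q \<le> real (Suc k) ^ 2 * q"
      by (intro mult_right_mono q) (simp add: power2_eq_square algebra_simps)
    then have "1 - real (Suc k) ^ 2 * q \<le> 0" using False by simp
    then have "N ^ Suc k / fact (Suc k) * (1 - real (Suc k) ^ 2 * q) \<le> 0"
      using N by (intro mult_nonneg_nonpos) auto
    then show ?thesis using i0[of "Suc k"] by linarith
  qed
  then show ?case by (simp add: i_def N_def q_def)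
qed

section \<open>Independent sets close to a fixed independent set \<open>M\<close>\<close>

text \<open>Such a set splits uniquely into its defects \<open>D = I - M\<close> and its trace
  \<open>S = I \<inter> M\<close>. A set \<open>D\<close> of size \<open>k\<close> leaves at least
  \<open>card M - d * k\<close> points free for \<open>S\<close>, and there are about
  \<open>card (V - M) ^ k / fact k\<close> choices of \<open>D\<close>, so the sum over
  \<open>k\<close> is a truncated exponential series. The loss \<open>\<delta>\<close> accounts for
  traces with at most \<open>t\<close> points, \<open>\<eta>\<close> for defect sets that are not
  independent, and the final \<open>- 1\<close> for the truncation at \<open>K\<close>.\<close>

lemma card_indep_sets_near_ge:
  assumes fin: "finite V" and M: "M \<in> indep_sets V adj" and ne: "M \<noteq> V"
    and sym: "\<And>u v. adj u v \<Longrightarrow> adj v u" and irrefl: "\<And>v. \<not> adj v v"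
    and degM: "\<And>v. v \<in> V - M \<Longrightarrow> card {u \<in> M. adj u v} \<le> d"
    and deg: "\<And>v. v \<in> V - M \<Longrightarrow> card {u \<in> V - M. adj u v} \<le> d"
    and delta: "2 ^ t * (3 / 4) ^ card M * (4 / 3) ^ (d * K) \<le> \<delta>" "\<delta> \<le> 1"
    and eta: "real K ^ 2 * (real d + 1) / real (card (V - M)) \<le> \<eta>" "\<eta> \<le> 1"
    and K: "3 * (real (card (V - M)) / 2 ^ d) \<le> real K"
  shows "real (card {I \<in> indep_sets V adj. card (I - M) \<le> K \<and> t < card (I \<inter> M)})
      \<ge> 2 ^ card M * (1 - \<delta>) * (1 - \<eta>) * (exp (real (card (V - M)) / 2 ^ d) - 1)"
proof -
  define W where "W = V - M"
  define \<mu> where "\<mu> = real (card W) / 2 ^ d"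
  define J where "J = {D \<in> indep_sets W adj. card D \<le> K}"
  \<comment> \<open>\<open>G D\<close> consists of the admissible traces on \<open>M\<close> for the
    defect set \<open>D\<close>.\<close>
  define G where "G = (\<lambda>D. {S. S \<subseteq> M - (\<Union>v\<in>D. {u \<in> M. adj u v}) \<and> t < card S})"
  have subM: "M \<subseteq> V" using M by (auto simp: indep_sets_def)
  have finW: "finite W" and finM: "finite M" using fin subM by (auto simp: W_def intro: finite_subset)
  have W0: "W \<noteq> {}" using subM ne by (auto simp: W_def)
  have finJ: "finite J" using indep_sets_finite[OF finW] by (simp add: J_def)
  have finG: "finite (G D)" for D
    by (rule finite_subset[of _ "Pow M"]) (use finM in \<open>auto simp: G_def\<close>)
  have finI: "finite (indep_sets V adj)" by (rule indep_sets_finite[OF fin])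

  have good: "real (card (G D)) \<ge> 2 ^ card M * (1 - \<delta>) * (1 / 2 ^ d) ^ card D" if D: "D \<in> J" for D
  proof -
    define A where "A = M - (\<Union>v\<in>D. {u \<in> M. adj u v})"
    have DW: "D \<subseteq> W" "card D \<le> K" using D by (auto simp: J_def indep_sets_def)
    have finD: "finite D" using DW finW finite_subset by blast
    have "card (\<Union>v\<in>D. {u \<in> M. adj u v}) \<le> (\<Sum>v\<in>D. card {u \<in> M. adj u v})"
      by (rule card_UN_le[OF finD])
    also have "\<dots> \<le> (\<Sum>v\<in>D. d)"
      using DW degM by (intro sum_mono) (auto simp: W_def)
    finally have "card (\<Union>v\<in>D. {u \<in> M. adj u v}) \<le> d * card D" by (simp add: mult.commute)
    moreover have "card M - card (\<Union>v\<in>D. {u \<in> M. adj u v}) \<le> card A"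
      unfolding A_def by (rule diff_card_le_card_Diff) (use finD finM in auto)
    ultimately have A: "card M \<le> card A + d * card D" by simp
    also have "\<dots> \<le> card A + d * K" using DW by simp
    finally have A': "card M \<le> card A + d * K" .
    have finA: "finite A" using finM by (simp add: A_def)
    \<comment> \<open>Since \<open>(3 / 4) * (4 / 3) = 1\<close>, the exponent can be padded by
      \<open>d * K\<close>, which lifts it to at least \<open>card M\<close> and yields a bound
      independent of \<open>D\<close>.\<close>
    have "2 ^ t * (3 / 4 :: real) ^ card A = 2 ^ t * (3 / 4) ^ (card A + d * K) * (4 / 3) ^ (d * K)"
      unfolding power_add mult.assoc
      by (subst power_mult_distrib[symmetric, of "3 / 4"]) simp
    also have "\<dots> \<le> 2 ^ t * (3 / 4) ^ card M * (4 / 3) ^ (d * K)"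
      using A' by (intro mult_right_mono mult_left_mono power_decreasing) auto
    also note delta(1)
    finally have bad: "1 - \<delta> \<le> 1 - 2 ^ t * (3 / 4 :: real) ^ card A" by (rule diff_left_mono)
    have "(2::real) ^ card M \<le> 2 ^ (card A + d * card D)" using A by (intro power_increasing) auto
    then have "2 ^ card M * (1 / 2 ^ d) ^ card D \<le> (2::real) ^ card A"
      by (simp add: power_add power_mult power_divide field_simps)
    then have "(2 ^ card M * (1 / 2 ^ d) ^ card D) * (1 - \<delta>) \<le> 2 ^ card A * (1 - 2 ^ t * (3 / 4 :: real) ^ card A)"
      by (intro mult_mono bad) (use delta in auto)
    also have "\<dots> \<le> real (card (G D))"
      using card_large_subsets_ge[OF finA, of t] by (simp add: G_def A_def)
    finally show ?thesis by (simp add: mult_ac)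
  qed

  have count: "real (card {D \<in> indep_sets W adj. card D = k}) * (1 / 2 ^ d) ^ k
      \<ge> (1 - \<eta>) * (\<mu> ^ k / fact k)" if "k \<le> K" for k
  proof -
    have "real k ^ 2 * (real d + 1) / real (card W) \<le> real K ^ 2 * (real d + 1) / real (card W)"
      using that by (intro divide_right_mono mult_right_mono power_mono) auto
    then have "1 - \<eta> \<le> 1 - real k ^ 2 * (real d + 1) / real (card W)"
      using eta by (simp add: W_def)
    then have "real (card W) ^ k / fact k * (1 - \<eta>)
        \<le> real (card W) ^ k / fact k * (1 - real k ^ 2 * (real d + 1) / real (card W))"
      by (intro mult_left_mono) auto
    also have "\<dots> \<le> real (card {D \<in> indep_sets W adj. card D = k})"
      by (rule card_indep_sets_ge[OF finW W0 sym irrefl]) (use deg in \<open>auto simp: W_def\<close>)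
    finally have "(real (card W) ^ k / fact k * (1 - \<eta>)) * (1 / 2 ^ d) ^ k
        \<le> real (card {D \<in> indep_sets W adj. card D = k}) * (1 / 2 ^ d) ^ k"
      by (intro mult_right_mono) auto
    then show ?thesis by (simp add: \<mu>_def power_divide mult_ac)
  qed

  have "(1 - \<eta>) * (exp \<mu> - 1) \<le> (1 - \<eta>) * (\<Sum>k\<le>K. \<mu> ^ k / fact k)"
    using eta K by (intro mult_left_mono exp_partial_sum_ge) (auto simp: \<mu>_def W_def)
  also have "\<dots> = (\<Sum>k\<le>K. (1 - \<eta>) * (\<mu> ^ k / fact k))" by (simp add: sum_distrib_left)
  also have "\<dots> \<le> (\<Sum>k\<le>K. real (card {D \<in> indep_sets W adj. card D = k}) * (1 / 2 ^ d) ^ k)"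
    by (intro sum_mono count) auto
  also have "\<dots> = (\<Sum>k\<le>K. \<Sum>D | D \<in> J \<and> card D = k. (1 / 2 ^ d) ^ card D)"
  proof (intro sum.cong refl)
    fix k assume "k \<in> {..K}"
    then have "{D \<in> indep_sets W adj. card D = k} = {D. D \<in> J \<and> card D = k}"
      by (auto simp: J_def)
    then show "real (card {D \<in> indep_sets W adj. card D = k}) * (1 / 2 ^ d) ^ k
        = (\<Sum>D | D \<in> J \<and> card D = k. (1 / 2 ^ d) ^ card D)" by simp
  qed
  \<comment> \<open>The sets in \<open>J\<close> were grouped by size; every size that occurs is at
    most \<open>K\<close>.\<close>
  also have "\<dots> = (\<Sum>D\<in>J. (1 / 2 ^ d) ^ card D)"
    by (intro sum.group finJ) (auto simp: J_def)
  finally have "2 ^ card M * (1 - \<delta>) * ((1 - \<eta>) * (exp \<mu> - 1))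
      \<le> 2 ^ card M * (1 - \<delta>) * (\<Sum>D\<in>J. (1 / 2 ^ d) ^ card D)"
    using delta by (intro mult_left_mono) auto
  also have "\<dots> = (\<Sum>D\<in>J. 2 ^ card M * (1 - \<delta>) * (1 / 2 ^ d) ^ card D)"
    by (simp add: sum_distrib_left)
  also have "\<dots> \<le> (\<Sum>D\<in>J. real (card (G D)))" by (intro sum_mono good)
  also have "\<dots> = real (card (SIGMA D:J. G D))"
    using finJ finG by (subst card_SigmaI) auto
  also have "card (SIGMA D:J. G D) \<le> card {I \<in> indep_sets V adj. card (I - M) \<le> K \<and> t < card (I \<inter> M)}"
  proof (rule card_inj_on_le)
    have parts: "(D \<union> S) - M = D" "(D \<union> S) \<inter> M = S" if "D \<in> J" "S \<in> G D" for D S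
      using that by (auto simp: J_def G_def indep_sets_def W_def)
    show "inj_on (\<lambda>(D, S). D \<union> S) (SIGMA D:J. G D)"
      by (rule inj_on_inverseI[where g = "\<lambda>I. (I - M, I \<inter> M)"])
        (clarify, simp only: prod.case parts)
    show "(\<lambda>(D, S). D \<union> S) ` (SIGMA D:J. G D)
        \<subseteq> {I \<in> indep_sets V adj. card (I - M) \<le> K \<and> t < card (I \<inter> M)}"
    proof clarsimp
      fix D S assume D: "D \<in> J" and S: "S \<in> G D"
      have "D \<union> S \<in> indep_sets V adj"
        using D S M sym unfolding J_def G_def indep_sets_def W_def by blast
      then show "D \<union> S \<in> indep_sets V adj \<and> card (D \<union> S - M) \<le> K \<and> t < card ((D \<union> S) \<inter> M)"
        unfolding parts[OF D S] using D S by (auto simp: J_def G_def)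
    qed
  qed (use finI in auto)
  finally show ?thesis by (simp add: \<mu>_def W_def mult_ac)
qed

section \<open>Adjacency in the torus of side length 3\<close>

lemma torus_adj_sym: "torus_adj m n u v \<Longrightarrow> torus_adj m n v u"
proof -
  have "[a = b + 1] (mod c) \<longleftrightarrow> [b = a - 1] (mod c)" for a b c :: int
    by (simp add: cong_iff_dvd_diff) (metis dvd_minus_iff minus_diff_eq diff_diff_eq2 diff_diff_eq add.commute)
  then show "torus_adj m n u v \<Longrightarrow> torus_adj m n v u"
    unfolding torus_adj_def by metis
qed

lemma not_torus_adj_self: "\<not> torus_adj 3 n v v"
  by (auto simp: torus_adj_def cong_iff_dvd_diff)

lemma torus_adjE:
  assumes "torus_adj 3 n u v"
  obtains j where "j < n" "u j \<noteq> v j" "\<And>i. i < n \<Longrightarrow> i \<noteq> j \<Longrightarrow> u i = v i"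
proof -
  from assms obtain j where j: "j < n" "\<And>i. i < n \<Longrightarrow> i \<noteq> j \<Longrightarrow> u i = v i"
    "[int (u j) = int (v j) + 1] (mod 3) \<or> [int (u j) = int (v j) - 1] (mod 3)"
    by (auto simp: torus_adj_def)
  from j(3) have "u j \<noteq> v j" by (auto simp: cong_iff_dvd_diff)
  then show thesis using that j(1,2) by blast
qed

lemma finite_torus_verts: "finite (torus_verts m n)"
  by (simp add: torus_verts_def finite_PiE)

lemma card_torus_verts: "card (torus_verts m n) = m ^ n"
  by (simp add: torus_verts_def card_PiE)

lemma torus_verts_eqI:
  assumes "u \<in> torus_verts m n" "v \<in> torus_verts m n" "\<And>i. i < n \<Longrightarrow> u i = v i"
  shows "u = v"
  using assms by (intro PiE_ext[of u "{..<n}" "\<lambda>_. {..<m}" v]) (auto simp: torus_verts_def)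

section \<open>Level sets of linear forms with coefficients 1 and -1 modulo 3\<close>

text \<open>
  Coefficients are normalised to \<open>1\<close> at coordinate 0, because a linear form and its negative
  have the same level sets.
\<close>

definition signs :: "nat \<Rightarrow> (nat \<Rightarrow> int) set" where
  "signs n = (\<Pi>\<^sub>E i\<in>{..<n}. if i = 0 then {1} else {1, -1})"

text \<open>These are affine hyperplanes over the field with three elements whose normal vector has
  no zero entry. Only \<open>c\<close> in \<open>{0, 1, 2}\<close> gives a nonempty set when
  \<open>n > 0\<close>, since \<open>mod 3\<close> returns these representatives.\<close>

definition level :: "nat \<Rightarrow> (nat \<Rightarrow> int) \<Rightarrow> int \<Rightarrow> (nat \<Rightarrow> nat) set" where
  "level n a c = {v \<in> torus_verts 3 n. (\<Sum>i<n. a i * int (v i)) mod 3 = c}"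

lemma signsD: "a \<in> signs n \<Longrightarrow> i < n \<Longrightarrow> a i = 1 \<or> a i = -1"
  by (auto simp: signs_def PiE_iff split: if_splits)

lemma signs_0: "a \<in> signs n \<Longrightarrow> 0 < n \<Longrightarrow> a 0 = 1"
  unfolding signs_def by (drule PiE_mem[where x = 0]) auto

lemma card_signs: "card (signs (Suc n)) = 2 ^ n"
  by (simp add: signs_def card_PiE lessThan_Suc_eq_insert_0 prod.reindex numeral_2_eq_2)

lemma level_subset: "level n a c \<subseteq> torus_verts 3 n"
  by (auto simp: level_def)

lemma finite_level: "finite (level n a c)"
  by (rule finite_subset[OF level_subset finite_torus_verts])

lemma level_dvd_diff:
  assumes "u \<in> level n a c" "v \<in> level n a c"
  shows "3 dvd (\<Sum>i<n. a i * int (u i)) - (\<Sum>i<n. a i * int (v i))"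
  using assms by (simp add: level_def mod_eq_dvd_iff[symmetric])

text \<open>Changing coordinate \<open>j\<close> alone changes the form by \<open>a j\<close> times
  the difference, and \<open>a j\<close> is invertible modulo 3. Hence a level set meets each
  axis-parallel line at most once, which underlies independence, the degree bounds and the
  cardinalities below.\<close>

lemma level_agree_except:
  assumes a: "a \<in> signs n" and u: "u \<in> level n a c" and v: "v \<in> level n a c"
    and j: "j < n" and eq: "\<And>i. i < n \<Longrightarrow> i \<noteq> j \<Longrightarrow> u i = v i"
  shows "u = v"
proof (rule torus_verts_eqI)
  show V: "u \<in> torus_verts 3 n" "v \<in> torus_verts 3 n" using u v by (auto simp: level_def)
  have "(\<Sum>i<n. a i * int (u i)) - (\<Sum>i<n. a i * int (v i))
      = (\<Sum>i<n. if i = j then a j * (int (u j) - int (v j)) else 0)"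
    unfolding sum_subtractf[symmetric] by (intro sum.cong) (auto simp: eq algebra_simps)
  also have "\<dots> = a j * (int (u j) - int (v j))" using j by simp
  finally have "3 dvd a j * (int (u j) - int (v j))"
    using level_dvd_diff[OF u v] by simp
  then have "3 dvd int (u j) - int (v j)"
    using signsD[OF a j] by (auto simp: dvd_diff_commute)
  moreover have "u j < 3" "v j < 3" using V j by (auto simp: torus_verts_def)
  ultimately have "u j = v j" by presburger
  with eq show "u i = v i" if "i < n" for i using that by (cases "i = j") auto
qed

lemma level_indep:
  assumes "a \<in> signs n"
  shows "level n a c \<in> indep_sets (torus_verts 3 n) (torus_adj 3 n)"
proof -
  have "\<not> torus_adj 3 n u v" if "u \<in> level n a c" "v \<in> level n a c" for u v
    using level_agree_except[OF assms that] by (metis torus_adjE)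
  then show ?thesis using level_subset by (auto simp: indep_sets_def)
qed

text \<open>On each of the \<open>n\<close> lines through \<open>v\<close>, a level set has exactly one point.\<close>

lemma card_level_neighbours_le:
  assumes a: "a \<in> signs n"
  shows "card {u \<in> level n a c. torus_adj 3 n u v} \<le> n"
proof -
  define L where "L = (\<lambda>j. {u \<in> level n a c. \<forall>i<n. i \<noteq> j \<longrightarrow> u i = v i})"
  have L: "card (L j) \<le> 1" if "j < n" for j
  proof -
    have "u = w" if "u \<in> L j" "w \<in> L j" for u w
      using that by (intro level_agree_except[OF a _ _ \<open>j < n\<close>]) (auto simp: L_def)
    moreover have "finite (L j)" by (simp add: L_def finite_level)
    ultimately show ?thesis by (simp add: card_le_Suc0_iff_eq)
  qed
  have "{u \<in> level n a c. torus_adj 3 n u v} \<subseteq> (\<Union>j<n. L j)"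
    by (auto simp: L_def elim!: torus_adjE)
  then have "card {u \<in> level n a c. torus_adj 3 n u v} \<le> card (\<Union>j<n. L j)"
    by (intro card_mono) (auto simp: L_def finite_level)
  also have "\<dots> \<le> (\<Sum>j<n. card (L j))" by (intro card_UN_le) simp
  also have "\<dots> \<le> (\<Sum>j<n. 1)" by (intro sum_mono L) simp
  finally show ?thesis by simp
qed

text \<open>A neighbour outside the level set lies in the third level, neither \<open>c\<close> nor that of \<open>v\<close>.\<close>

lemma card_complement_neighbours_le:
  assumes a: "a \<in> signs n" and c: "c \<in> {0, 1, 2}" and v: "v \<in> torus_verts 3 n - level n a c"
  shows "card {u \<in> torus_verts 3 n - level n a c. torus_adj 3 n u v} \<le> n"
proof -
  define f where "f = (\<lambda>v. (\<Sum>i<n. a i * int (v i)) mod 3)"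
  have range: "f w \<in> {0, 1, 2}" for w
    unfolding f_def by (simp; presburger)
  have "f v \<noteq> c" using v by (auto simp: level_def f_def)
  then have "\<exists>d. \<forall>x\<in>{0, 1, 2}. x \<noteq> c \<longrightarrow> x \<noteq> f v \<longrightarrow> x = d"
    using c range[of v] by auto
  then obtain d where d: "\<And>x. x \<in> {0, 1, 2} \<Longrightarrow> x \<noteq> c \<Longrightarrow> x \<noteq> f v \<Longrightarrow> x = d"
    by blast
  have "{u \<in> torus_verts 3 n - level n a c. torus_adj 3 n u v} \<subseteq> {u \<in> level n a d. torus_adj 3 n u v}"
  proof (rule subsetI)
    fix u assume "u \<in> {u \<in> torus_verts 3 n - level n a c. torus_adj 3 n u v}"
    then have u: "u \<in> torus_verts 3 n" "u \<notin> level n a c" "torus_adj 3 n u v" by auto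
    have "f u \<noteq> f v"
    proof
      assume "f u = f v"
      then have "u \<in> level n a (f v)" "v \<in> level n a (f v)"
        using u v by (auto simp: level_def f_def)
      then show False using level_indep[OF a, of "f v"] u by (auto simp: indep_sets_def)
    qed
    moreover have "f u \<noteq> c" using u by (auto simp: level_def f_def)
    ultimately have "f u = d" using d range by blast
    then show "u \<in> {u \<in> level n a d. torus_adj 3 n u v}" using u by (auto simp: level_def f_def)
  qed
  then have "card {u \<in> torus_verts 3 n - level n a c. torus_adj 3 n u v}
      \<le> card {u \<in> level n a d. torus_adj 3 n u v}"
    by (intro card_mono) (auto simp: finite_level)
  also have "\<dots> \<le> n" by (rule card_level_neighbours_le[OF a])
  finally show ?thesis .
qed

text \<open>Each of the three levels has at most \<open>3 ^ n\<close> points, and together they have \<open>3 ^ Suc n\<close>.\<close>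

lemma card_level:
  assumes a: "a \<in> signs (Suc n)" and c: "c \<in> {0, 1, 2}"
  shows "card (level (Suc n) a c) = 3 ^ n"
proof -
  have le: "card (level (Suc n) a c) \<le> 3 ^ n" for c
  proof -
    have "card (level (Suc n) a c) \<le> card ({1..n} \<rightarrow>\<^sub>E {..<3::nat})"
    proof (rule card_inj_on_le)
      \<comment> \<open>Coordinate 0 may be forgotten: the level and the other coordinates determine
        it.\<close>
      show "inj_on (\<lambda>v. restrict v {1..n}) (level (Suc n) a c)"
      proof (rule inj_onI)
        fix u v assume uv: "u \<in> level (Suc n) a c" "v \<in> level (Suc n) a c"
          and eq: "restrict u {1..n} = restrict v {1..n}"
        have "u i = v i" if "i < Suc n" "i \<noteq> 0" for i
          using that fun_cong[OF eq, of i] by auto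
        then show "u = v" by (intro level_agree_except[OF a uv, of 0]) auto
      qed
      show "(\<lambda>v. restrict v {1..n}) ` level (Suc n) a c \<subseteq> {1..n} \<rightarrow>\<^sub>E {..<3}"
        unfolding level_def torus_verts_def
        by (force simp: image_subset_iff restrict_PiE_iff dest: PiE_mem)
    qed (simp add: finite_PiE)
    then show ?thesis by (simp add: card_PiE)
  qed
  have "torus_verts 3 (Suc n) = level (Suc n) a 0 \<union> level (Suc n) a 1 \<union> level (Suc n) a 2"
    unfolding level_def by (auto; presburger)
  then have "3 ^ Suc n = card (level (Suc n) a 0 \<union> level (Suc n) a 1 \<union> level (Suc n) a 2)"
    by (metis card_torus_verts)
  also have "\<dots> = card (level (Suc n) a 0) + card (level (Suc n) a 1) + card (level (Suc n) a 2)"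
    by (subst card_Un_disjoint, simp_all add: finite_level, force simp: level_def)+
  finally show ?thesis using le[of 0] le[of 1] le[of 2] c by auto
qed

text \<open>Two levels of one form are disjoint. Distinct forms agree at coordinate 0 and have
  opposite signs at some \<open>j\<close>, so the two equations in coordinates 0 and
  \<open>j\<close> have determinant 2 or -2, which is invertible modulo 3. The remaining
  \<open>p\<close> coordinates therefore determine a common point.\<close>

lemma card_level_Int_le:
  assumes a: "a \<in> signs (Suc (Suc p))" and b: "b \<in> signs (Suc (Suc p))"
    and ne: "(a, c) \<noteq> (b, d)"
  shows "card (level (Suc (Suc p)) a c \<inter> level (Suc (Suc p)) b d) \<le> 3 ^ p"
proof (cases "a = b")
  case True
  then have "level (Suc (Suc p)) a c \<inter> level (Suc (Suc p)) b d = {}"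
    using ne by (auto simp: level_def)
  then show ?thesis by simp
next
  case False
  define n where "n = Suc (Suc p)"
  have an: "a \<in> signs n" and bn: "b \<in> signs n" using a b by (auto simp: n_def)
  obtain j where j: "j < n" "a j \<noteq> b j"
    using False PiE_ext[of a "{..<n}" _ b] an bn unfolding signs_def by (metis lessThan_iff)
  \<comment> \<open>The normalisation at coordinate 0 forces the differing coordinate
    \<open>j\<close> to be another one.\<close>
  have a0: "a 0 = 1" "b 0 = 1" using signs_0[OF an] signs_0[OF bn] by (auto simp: n_def)
  with j have j0: "j \<noteq> 0" by metis
  define E where "E = {..<n} - {0, j}"
  have "card (level n a c \<inter> level n b d) \<le> card (E \<rightarrow>\<^sub>E {..<3::nat})"
  proof (rule card_inj_on_le)
    show "inj_on (\<lambda>v. restrict v E) (level n a c \<inter> level n b d)"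
    proof (rule inj_onI)
      fix u v assume uv: "u \<in> level n a c \<inter> level n b d" "v \<in> level n a c \<inter> level n b d"
        and eq: "restrict u E = restrict v E"
      have ag: "u i = v i" if "i < n" "i \<noteq> 0" "i \<noteq> j" for i
        using that fun_cong[OF eq, of i] by (auto simp: E_def)
      have diff: "(\<Sum>i<n. e i * int (u i)) - (\<Sum>i<n. e i * int (v i))
          = e 0 * (int (u 0) - int (v 0)) + e j * (int (u j) - int (v j))" for e :: "nat \<Rightarrow> int"
      proof -
        have "(\<Sum>i<n. e i * int (u i)) - (\<Sum>i<n. e i * int (v i))
          = (\<Sum>i<n. (if i = 0 then e 0 * (int (u 0) - int (v 0)) else 0)
                + (if i = j then e j * (int (u j) - int (v j)) else 0))"
          unfolding sum_subtractf[symmetric] using j0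
          by (intro sum.cong) (auto simp: ag algebra_simps)
        also have "\<dots> = e 0 * (int (u 0) - int (v 0)) + e j * (int (u j) - int (v j))"
          using j by (simp add: sum.distrib n_def)
        finally show ?thesis .
      qed
      have "3 dvd (int (u 0) - int (v 0)) + a j * (int (u j) - int (v j))"
        using level_dvd_diff[of u n a c v] uv unfolding diff a0 by simp
      moreover have "3 dvd (int (u 0) - int (v 0)) + b j * (int (u j) - int (v j))"
        using level_dvd_diff[of u n b d v] uv unfolding diff a0 by simp
      moreover have "a j = 1 \<and> b j = -1 \<or> a j = -1 \<and> b j = 1"
        using signsD[OF an j(1)] signsD[OF bn j(1)] j(2) by auto
      \<comment> \<open>Subtracting the two divisibilities leaves twice the difference at
        \<open>j\<close>, up to sign.\<close>
      ultimately have dvd: "3 dvd int (u j) - int (v j)"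
        by (elim disjE conjE; simp; presburger)
      moreover have "u j < 3" "v j < 3" using uv j by (auto simp: level_def torus_verts_def)
      ultimately have "u j = v j" by presburger
      then have "u i = v i" if "i < n" "i \<noteq> 0" for i using ag that by (cases "i = j") auto
      then show "u = v"
        using uv by (intro level_agree_except[OF an, of _ c _ 0]) (auto simp: n_def)
    qed
    show "(\<lambda>v. restrict v E) ` (level n a c \<inter> level n b d) \<subseteq> E \<rightarrow>\<^sub>E {..<3}"
      unfolding level_def torus_verts_def E_def
      by (force simp: image_subset_iff restrict_PiE_iff n_def dest: PiE_mem)
  qed (simp add: finite_PiE E_def)
  also have "\<dots> = 3 ^ p"
    using j j0 by (simp add: card_PiE E_def card_Diff_subset n_def)
  finally show ?thesis by (simp add: n_def)
qed

section \<open>Summing over all level sets\<close>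

text \<open>The local count is applied to every level set with \<open>d = n\<close> and
  \<open>t = 3 ^ p + K\<close>. Here \<open>n = p + 2\<close>, so \<open>3 ^ p\<close> bounds the
  overlap of two level sets and \<open>3 ^ Suc p\<close> is the size of each. The threshold
  \<open>t\<close> is the least that the disjointness argument allows.\<close>

lemma card_torus_indep_sets_ge:
  fixes p K :: nat
  defines "n \<equiv> Suc (Suc p)" and "\<mu> \<equiv> (3 / 2 :: real) ^ Suc p"
  assumes delta: "2 ^ (3 ^ p + K) * (3 / 4) ^ (3 ^ Suc p) * (4 / 3) ^ (n * K) \<le> \<delta>" "\<delta> \<le> 1"
    and eta: "real K ^ 2 * (real n + 1) / (2 * 3 ^ Suc p) \<le> \<eta>" "\<eta> \<le> 1"
    and K: "3 * \<mu> \<le> real K"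
  shows "real (card (torus_indep_sets 3 n))
      \<ge> 3 * 2 ^ Suc p * (2 ^ (3 ^ Suc p) * (1 - \<delta>) * (1 - \<eta>) * (exp \<mu> - 1))"
proof -
  define V where "V = torus_verts 3 n"
  define F where "F = (\<lambda>(a, c). {I \<in> torus_indep_sets 3 n. card (I - level n a c) \<le> K
      \<and> 3 ^ p + K < card (I \<inter> level n a c)})"
  define T where "T = signs n \<times> {0, 1, 2 :: int}"
  have finI: "finite (torus_indep_sets 3 n)"
    by (simp add: torus_indep_sets_def indep_sets_finite finite_torus_verts)
  have finF: "finite (F x)" for x using finI by (cases x) (simp add: F_def)
  have cT: "card T = 3 * 2 ^ Suc p"
    by (simp add: T_def n_def card_signs card_cartesian_product)
  have finT: "finite T" by (rule card_ge_0_finite) (simp add: cT)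
  have F: "2 ^ (3 ^ Suc p) * (1 - \<delta>) * (1 - \<eta>) * (exp \<mu> - 1) \<le> real (card (F x))" if xT: "x \<in> T" for x
  proof -
    obtain a c where x: "x = (a, c)" and a: "a \<in> signs n" and c: "c \<in> {0, 1, 2}"
      using xT unfolding T_def by (metis mem_Sigma_iff surj_pair)
    define M where "M = level n a c"
    have cM: "card M = 3 ^ Suc p" using card_level[of a "Suc p" c] a c by (simp add: M_def n_def)
    have cV: "card V = 3 * 3 ^ Suc p" by (simp add: V_def card_torus_verts n_def)
    have MV: "M \<subseteq> V" by (simp add: M_def V_def level_subset)
    have cW: "card (V - M) = 2 * 3 ^ Suc p"
      using MV cM cV by (subst card_Diff_subset) (auto simp: M_def finite_level)
    have mu: "real (card (V - M)) / 2 ^ n = \<mu>" by (simp add: cW \<mu>_def n_def power_divide)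
    have "2 ^ card M * (1 - \<delta>) * (1 - \<eta>) * (exp (real (card (V - M)) / 2 ^ n) - 1)
      \<le> real (card {I \<in> indep_sets V (torus_adj 3 n). card (I - M) \<le> K \<and> 3 ^ p + K < card (I \<inter> M)})"
    proof (rule card_indep_sets_near_ge)
      show "finite V" by (simp add: V_def finite_torus_verts)
      show "M \<in> indep_sets V (torus_adj 3 n)" using level_indep[OF a] by (simp add: M_def V_def)
      show "M \<noteq> V" using cM cV by auto
      show "card {u \<in> M. torus_adj 3 n u v} \<le> n" for v
        using card_level_neighbours_le[OF a] by (simp add: M_def)
      show "card {u \<in> V - M. torus_adj 3 n u v} \<le> n" if "v \<in> V - M" for v
        using card_complement_neighbours_le[OF a c] that unfolding M_def V_def by blast
    qed (use delta eta K in \<open>simp_all add: torus_adj_sym not_torus_adj_self cM mu\<close>, simp_all add: cW)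
    then show ?thesis
      unfolding cM mu x F_def torus_indep_sets_def by (simp add: V_def M_def)
  qed
  have disj: "F x \<inter> F y = {}" if xy: "x \<in> T" "y \<in> T" "x \<noteq> y" for x y
  proof (rule equals0I)
    fix I assume I: "I \<in> F x \<inter> F y"
    obtain a c b d where [simp]: "x = (a, c)" "y = (b, d)" by (metis surj_pair)
    have "I \<subseteq> V" using I by (auto simp: F_def torus_indep_sets_def indep_sets_def V_def)
    then have finI: "finite I" by (rule finite_subset) (simp add: V_def finite_torus_verts)
    \<comment> \<open>A set close to the second level set has few points of the first: each lies in
      the overlap or is one of at most \<open>K\<close> defects.\<close>
    have "card (I \<inter> level n a c) \<le> card ((level n a c \<inter> level n b d) \<union> (I - level n b d))"
      using finI by (intro card_mono) (auto simp: finite_level)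
    also have "\<dots> \<le> card (level n a c \<inter> level n b d) + card (I - level n b d)"
      by (rule card_Un_le)
    also have "\<dots> \<le> 3 ^ p + K"
      using card_level_Int_le[of a p b c d] xy I by (intro add_mono) (auto simp: T_def F_def n_def)
    finally show False using I by (auto simp: F_def)
  qed
  have "3 * 2 ^ Suc p * (2 ^ (3 ^ Suc p) * (1 - \<delta>) * (1 - \<eta>) * (exp \<mu> - 1))
      = (\<Sum>x\<in>T. 2 ^ (3 ^ Suc p) * (1 - \<delta>) * (1 - \<eta>) * (exp \<mu> - 1))"
    by (simp add: cT)
  also have "\<dots> \<le> (\<Sum>x\<in>T. real (card (F x)))" by (intro sum_mono F)
  also have "\<dots> = real (card (\<Union>x\<in>T. F x))"
    using finT finF disj by (subst card_UN_disjoint) auto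
  also have "\<dots> \<le> real (card (torus_indep_sets 3 n))"
    by (intro of_nat_mono card_mono finI) (auto simp: F_def)
  finally show ?thesis .
qed

section \<open>Choice of the error terms and passage to the limit\<close>

theorem theorem1p1:
  shows "\<exists>\<epsilon> :: nat \<Rightarrow> real. \<epsilon> \<longlonglongrightarrow> 0 \<and>
    (\<forall>n\<ge>1. real (card (torus_indep_sets 3 n)) \<ge>
       (1 - \<epsilon> n) * 3 * 2 ^ (n - 1) * 2 ^ (3 ^ (n - 1)) * exp ((3 / 2) ^ (n - 1)))"
proof -
  \<comment> \<open>All error terms are indexed by \<open>p = n - 2\<close>.\<close>
  define \<mu> where "\<mu> = (\<lambda>p. (3 / 2 :: real) ^ Suc p)"
  \<comment> \<open>The base is \<open>27 / 32 = 2 * (3 / 4) ^ 3\<close>; the second factor bounds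
    \<open>2 ^ ((p + 3) * K)\<close> through \<open>K \<le> 3 * \<mu> p + 1\<close>. The exponent
    \<open>3 ^ p\<close> outgrows \<open>p * (3 / 2) ^ p\<close>, so the product tends to 0.\<close>
  define \<delta> where "\<delta> = (\<lambda>p. (27 / 32 :: real) ^ 3 ^ p * 2 powr ((real p + 3) * (3 * \<mu> p + 1)))"
  \<comment> \<open>This comes from \<open>K \<le> 4 * \<mu> p\<close>: the ratio is
    \<open>\<mu> p ^ 2 / 3 ^ Suc p = (3 / 4) ^ Suc p\<close>, and \<open>16 / 2 = 8\<close>.\<close>
  define \<eta> where "\<eta> = (\<lambda>p. 8 * (real p + 3) * (3 / 4 :: real) ^ Suc p)"
  \<comment> \<open>The last summand is the relative cost of \<open>exp (\<mu> p) - 1\<close>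
    against \<open>exp (\<mu> p)\<close>.\<close>
  define \<epsilon> where "\<epsilon> = (\<lambda>p. \<delta> p + \<eta> p + exp (- \<mu> p))"
  have "\<delta> \<longlonglongrightarrow> 0" unfolding \<delta>_def \<mu>_def by real_asymp
  moreover have "\<eta> \<longlonglongrightarrow> 0" unfolding \<eta>_def by real_asymp
  moreover have "(\<lambda>p. exp (- \<mu> p)) \<longlonglongrightarrow> 0" unfolding \<mu>_def by real_asymp
  ultimately have "(\<lambda>p. \<delta> p + \<eta> p + exp (- \<mu> p)) \<longlonglongrightarrow> 0 + 0 + 0"
    by (intro tendsto_add)
  then have lim: "\<epsilon> \<longlonglongrightarrow> 0" by (simp add: \<epsilon>_def)
  have \<mu>1: "\<mu> p \<ge> 1" for p unfolding \<mu>_def by (rule one_le_power) simp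
  have nonneg: "\<delta> p \<ge> 0" "\<eta> p \<ge> 0" for p by (simp_all add: \<delta>_def \<eta>_def)
  have bound: "real (card (torus_indep_sets 3 (Suc (Suc p))))
      \<ge> (1 - \<epsilon> p) * 3 * 2 ^ Suc p * 2 ^ (3 ^ Suc p) * exp (\<mu> p)" for p
  \<comment> \<open>If \<open>\<delta> p\<close> or \<open>\<eta> p\<close> exceeds 1, then
    \<open>1 - \<epsilon> p\<close> is at most 0 and the bound is trivial.\<close>
  proof (cases "\<delta> p \<le> 1 \<and> \<eta> p \<le> 1")
    case True
    define K where "K = nat \<lceil>3 * \<mu> p\<rceil>"
    have K: "3 * \<mu> p \<le> real K" "real K \<le> 3 * \<mu> p + 1"
      unfolding K_def using \<mu>1[of p] by linarith+
    have cube: "(3 / 4 :: real) ^ (3 ^ Suc p) = (27 / 64) ^ (3 ^ p)"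
      by (simp add: power_mult power_divide)
    \<comment> \<open>Replacing \<open>4 / 3\<close> by 2 is crude but lets all factors containing
      \<open>K\<close> merge into one power of 2.\<close>
    have "2 ^ (3 ^ p + K) * (3 / 4) ^ (3 ^ Suc p) * (4 / 3) ^ (Suc (Suc p) * K)
        \<le> 2 ^ (3 ^ p + K) * (27 / 64) ^ (3 ^ p) * (2 :: real) ^ (Suc (Suc p) * K)"
      unfolding cube by (intro mult_left_mono power_mono) auto
    also have "2 ^ (3 ^ p + K) * (27 / 64) ^ (3 ^ p) * (2 :: real) ^ (Suc (Suc p) * K)
        = (2 ^ 3 ^ p * (27 / 64) ^ (3 ^ p)) * (2 ^ K * 2 ^ (Suc (Suc p) * K))"
      by (simp only: power_add mult_ac)
    also have "2 ^ 3 ^ p * (27 / 64) ^ (3 ^ p) = (27 / 32 :: real) ^ 3 ^ p"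
      by (simp add: power_mult_distrib[symmetric])
    also have "(2::real) ^ K * 2 ^ (Suc (Suc p) * K) = 2 ^ ((p + 3) * K)"
      by (simp add: power_add[symmetric] algebra_simps)
    also have "\<dots> = 2 powr ((real p + 3) * real K)"
      by (simp add: powr_realpow[symmetric])
    also have "\<dots> \<le> 2 powr ((real p + 3) * (3 * \<mu> p + 1))"
      by (intro powr_mono mult_left_mono K) auto
    finally have delta: "2 ^ (3 ^ p + K) * (3 / 4) ^ (3 ^ Suc p) * (4 / 3) ^ (Suc (Suc p) * K) \<le> \<delta> p"
      by (simp add: \<delta>_def)
    \<comment> \<open>Since \<open>\<mu> p\<close> is at least 1,
      \<open>K \<le> 3 * \<mu> p + 1 \<le> 4 * \<mu> p\<close>.\<close>
    have "real K ^ 2 * (real (Suc (Suc p)) + 1) / (2 * 3 ^ Suc p)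
        \<le> (4 * \<mu> p) ^ 2 * (real (Suc (Suc p)) + 1) / (2 * 3 ^ Suc p)"
      using K \<mu>1[of p] by (intro divide_right_mono mult_right_mono power_mono) auto
    also have "(4 * \<mu> p) ^ 2 = 16 * (9 / 4) ^ Suc p"
    proof -
      have "\<mu> p ^ 2 = (9 / 4) ^ Suc p"
        unfolding \<mu>_def power2_eq_square by (subst power_mult_distrib[symmetric]) simp
      then show ?thesis by (simp only: power_mult_distrib) simp
    qed
    also have "16 * (9 / 4) ^ Suc p * (real (Suc (Suc p)) + 1) / (2 * 3 ^ Suc p) = \<eta> p"
    proof -
      have "(9 / 4 :: real) ^ Suc p = (3 / 4) ^ Suc p * 3 ^ Suc p"
        by (subst power_mult_distrib[symmetric]) simp
      then show ?thesis by (simp add: \<eta>_def)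
    qed
    finally have eta: "real K ^ 2 * (real (Suc (Suc p)) + 1) / (2 * 3 ^ Suc p) \<le> \<eta> p" .
    have "1 - \<epsilon> p \<le> (1 - \<delta> p) * (1 - \<eta> p) * (1 - exp (- \<mu> p))"
    proof -
      define z where "z = exp (- \<mu> p)"
      have z: "0 \<le> z" "z \<le> 1" using \<mu>1[of p] by (auto simp: z_def)
      have "(1 - \<delta> p) * (1 - \<eta> p) * z \<le> 1 * 1 * z"
        using True nonneg[of p] z by (intro mult_right_mono mult_mono) auto
      moreover have "\<delta> p * \<eta> p \<ge> 0" using nonneg by simp
      ultimately show ?thesis by (simp add: \<epsilon>_def z_def[symmetric] algebra_simps)
    qed
    then have "3 * 2 ^ Suc p * 2 ^ (3 ^ Suc p) * exp (\<mu> p) * (1 - \<epsilon> p)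
        \<le> 3 * 2 ^ Suc p * 2 ^ (3 ^ Suc p) * exp (\<mu> p) * ((1 - \<delta> p) * (1 - \<eta> p) * (1 - exp (- \<mu> p)))"
      by (intro mult_left_mono) auto
    also have "\<dots> = 3 * 2 ^ Suc p * (2 ^ (3 ^ Suc p) * (1 - \<delta> p) * (1 - \<eta> p) * (exp (\<mu> p) * (1 - exp (- \<mu> p))))"
      by (simp only: mult_ac)
    also have "exp (\<mu> p) * (1 - exp (- \<mu> p)) = exp (\<mu> p) - 1"
      by (simp add: algebra_simps exp_add[symmetric])
    also have "3 * 2 ^ Suc p * (2 ^ (3 ^ Suc p) * (1 - \<delta> p) * (1 - \<eta> p) * (exp (\<mu> p) - 1))
        \<le> real (card (torus_indep_sets 3 (Suc (Suc p))))"
      using card_torus_indep_sets_ge[OF delta _ eta] True K(1) unfolding \<mu>_def by blast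
    finally show ?thesis by (simp only: mult_ac)
  next
    case False
    then have "1 - \<epsilon> p \<le> 0" using nonneg[of p] by (auto simp: \<epsilon>_def intro: add_increasing2)
    then have "(1 - \<epsilon> p) * (3 * 2 ^ Suc p * 2 ^ (3 ^ Suc p) * exp (\<mu> p)) \<le> 0"
      by (intro mult_nonpos_nonneg) auto
    then show ?thesis by (simp only: mult.assoc order.trans[OF _ of_nat_0_le_iff])
  qed
  \<comment> \<open>The value 1 for \<open>n < 2\<close> makes the lower bound 0 there; the shift by
    2 does not affect the limit.\<close>
  define e where "e = (\<lambda>n. if n < 2 then 1 else \<epsilon> (n - 2))"
  have "(\<lambda>p. e (p + 2)) = \<epsilon>" by (simp add: e_def)
  then have "e \<longlonglongrightarrow> 0" using lim LIMSEQ_offset[of e 2 0] by simp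
  moreover have "real (card (torus_indep_sets 3 n))
      \<ge> (1 - e n) * 3 * 2 ^ (n - 1) * 2 ^ (3 ^ (n - 1)) * exp ((3 / 2) ^ (n - 1))" for n
  proof (cases "n < 2")
    case False
    then obtain p where "n = Suc (Suc p)" by (metis One_nat_def less_2_cases_iff not0_implies_Suc)
    then show ?thesis using bound[of p] by (simp add: e_def \<mu>_def)
  qed (simp add: e_def)
  ultimately show ?thesis by blast
qed

end
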